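(* Let $M$ be a $0/\pm1$ matrix. If the bipartite graph $G(M)$ is a forest, then $(\mathrm{Part}(M),\preceq)$ is partially well-ordered (it contains no infinite antichain and no infinite strictly decreasing sequence).
   Context: For a matrix $P$ and integers $a\le b$, $c\le d$, $P_{[a,b)\times[c,d)}$ denotes the (possibly empty) submatrix of rows $a,\dots,b-1$ and columns $c,\dots,d-1$. A submatrix of a permutation matrix is increasing if its nonzero entries, listed in order of increasing row index, have strictly increasing column indices, and decreasing if strictly decreasing (a zero or empty submatrix is both). For an $r\times s$ matrix $M$ with entries in $\{0,1,-1\}$ and an $n\times n$ permutation matrix $P$, an $M$-partition of $P$ is a pair of multisets $I=\{1=i_1\le\dots\le i_{r+1}=n+1\}$, $J=\{1=j_1\le\dots\le j_{s+1}=n+1\}$ such that for all $k\in[r]$, $\ell\in[s]$: $P_{[i_k,i_{k+1})\times[j_\ell,j_{\ell+1})}$ is zero if $M_{k,\ell}=0$, increasing if $M_{k,\ell}=1$, decreasing if $M_{k,\ell}=-1$. $\mathrm{Part}(M)$ is the set of triples $(P,I,J)$ with $P$ a permutation matrix and $(I,J)$ an $M$-partition of $P$. For a matrix $P$, $\mathrm{supp}(P)$ is the set of positions of nonzero entries; for a finite set $X$ of positions, $\Delta(X)$ is the smallest $0/1$ matrix with support $X$, and $\mathrm{red}(Q)$ is obtained from $Q$ by deleting all all-zero rows and columns. For $(P,I,J),(P',I',J')\in\mathrm{Part}(M)$ with $I=\{i_1\le\dots\le i_{r+1}\}$, $J=\{j_1\le\dots\le j_{s+1}\}$, $I'=\{i'_1\le\dots\le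 i'_{r+1}\}$, $J'=\{j'_1\le\dots\le j'_{s+1}\}$, write $(P',I',J')\preceq(P,I,J)$ if there is $X\subseteq\mathrm{supp}(P)$ with $\mathrm{red}(\Delta(X))=P'$ and, for all $k\in[r],\ell\in[s]$, $|X\cap([i_k,i_{k+1})\times[j_\ell,j_{\ell+1}))|=|\mathrm{supp}(P')\cap([i'_k,i'_{k+1})\times[j'_\ell,j'_{\ell+1}))|$; this is a partial order. The bipartite graph $G(M)$ has vertices $x_1,\dots,x_r,y_1,\dots,y_s$ and an edge $x_iy_j$ whenever $M_{i,j}\ne0$. *)

theory Defs
  imports "Jordan_Normal_Form.DL_Submatrix" "Graph_Theory.Graph_Theory"
begin

text \<open>
  Rows and columns of matrices are numbered from 0, so the interval \<open>[a, b)\<close> of 1-based indices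
  appears here as \<open>{a - 1..<b - 1}\<close>, and the end points 1 and \<open>n + 1\<close> of a partition become 0
  and \<open>n\<close>.
\<close>

definition supp :: "'a::zero mat \<Rightarrow> (nat \<times> nat) set" where
  "supp Q = {(i, j). i < dim_row Q \<and> j < dim_col Q \<and> Q $$ (i, j) \<noteq> 0}"

definition permutation_matrix :: "int mat \<Rightarrow> bool" where
  "permutation_matrix P \<longleftrightarrow>
     square_mat P \<and> elements_mat P \<subseteq> {0, 1} \<and>
     (\<forall>i < dim_row P. \<exists>!j. j < dim_col P \<and> P $$ (i, j) = 1) \<and>
     (\<forall>j < dim_col P. \<exists>!i. i < dim_row P \<and> P $$ (i, j) = 1)"

definition increasing_mat :: "'a::zero mat \<Rightarrow> bool" where
  "increasing_mat Q \<longleftrightarrow>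
     (\<forall>(i, j) \<in> supp Q. \<forall>(i', j') \<in> supp Q. i < i' \<longrightarrow> j < j')"

definition decreasing_mat :: "'a::zero mat \<Rightarrow> bool" where
  "decreasing_mat Q \<longleftrightarrow>
     (\<forall>(i, j) \<in> supp Q. \<forall>(i', j') \<in> supp Q. i < i' \<longrightarrow> j' < j)"

text \<open>A multiset \<open>{i\<^sub>1 \<le> \<dots> \<le> i\<^bsub>m+1\<^esub>}\<close> is represented by the sorted list of its elements.\<close>

definition division :: "nat \<Rightarrow> nat \<Rightarrow> nat list \<Rightarrow> bool" where
  "division m n I \<longleftrightarrow> length I = m + 1 \<and> sorted I \<and> I ! 0 = 0 \<and> I ! m = n"

abbreviation part_interval :: "nat list \<Rightarrow> nat \<Rightarrow> nat set" where
  "part_interval I k \<equiv> {I ! k..<I ! (k + 1)}"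

definition M_partition :: "int mat \<Rightarrow> int mat \<Rightarrow> nat list \<Rightarrow> nat list \<Rightarrow> bool" where
  "M_partition M P I J \<longleftrightarrow>
     division (dim_row M) (dim_row P) I \<and> division (dim_col M) (dim_col P) J \<and>
     (\<forall>k < dim_row M. \<forall>l < dim_col M.
        let Q = submatrix P (part_interval I k) (part_interval J l) in
          (M $$ (k, l) = 0 \<longrightarrow> Q = 0\<^sub>m (dim_row Q) (dim_col Q)) \<and>
          (M $$ (k, l) = 1 \<longrightarrow> increasing_mat Q) \<and>
          (M $$ (k, l) = -1 \<longrightarrow> decreasing_mat Q))"

definition Part :: "int mat \<Rightarrow> (int mat \<times> nat list \<times> nat list) set" where
  "Part M = {(P, I, J). permutation_matrix P \<and> M_partition M P I J}"

text \<open>The smallest 0/1 matrix with support \<open>X\<close>, for finite \<open>X\<close>; it has no rows and no columns if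
  \<open>X\<close> is empty.\<close>

definition delta_mat :: "(nat \<times> nat) set \<Rightarrow> int mat" where
  "delta_mat X =
     mat (Max (insert 0 ((\<lambda>(i, j). i + 1) ` X))) (Max (insert 0 ((\<lambda>(i, j). j + 1) ` X)))
       (\<lambda>p. if p \<in> X then 1 else 0)"

lemma supp_delta_mat:
  assumes "finite X"
  shows "supp (delta_mat X) = X"
proof -
  have "i < Max (insert 0 ((\<lambda>(i, j). i + 1) ` X)) \<and> j < Max (insert 0 ((\<lambda>(i, j). j + 1) ` X))"
    if "(i, j) \<in> X" for i j
  proof -
    have "i + 1 \<le> Max (insert 0 ((\<lambda>(i, j). i + 1) ` X))"
      "j + 1 \<le> Max (insert 0 ((\<lambda>(i, j). j + 1) ` X))"
      using assms that by (auto intro!: Max_ge rev_image_eqI)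
    then show ?thesis by simp
  qed
  then show ?thesis
    by (auto simp: supp_def delta_mat_def split: if_splits)
qed

lemma delta_mat_smallest:
  assumes "finite X" "X \<subseteq> {..<m} \<times> {..<n}"
  shows "dim_row (delta_mat X) \<le> m" "dim_col (delta_mat X) \<le> n"
  using assms by (auto simp: delta_mat_def Max_le_iff)

definition red :: "'a::zero mat \<Rightarrow> 'a mat" where
  "red Q = submatrix Q {i. \<exists>j. (i, j) \<in> supp Q} {j. \<exists>i. (i, j) \<in> supp Q}"

fun part_le ::
  "int mat \<Rightarrow> int mat \<times> nat list \<times> nat list \<Rightarrow> int mat \<times> nat list \<times> nat list \<Rightarrow> bool" where
  "part_le M (P', I', J') (P, I, J) \<longleftrightarrow>
     (\<exists>X \<subseteq> supp P. red (delta_mat X) = P' \<and>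
        (\<forall>k < dim_row M. \<forall>l < dim_col M.
           card (X \<inter> part_interval I k \<times> part_interval J l) =
           card (supp P' \<inter> part_interval I' k \<times> part_interval J' l)))"

text \<open>The bipartite graph has the vertex \<open>x\<^sub>i\<close> as \<open>Inl i\<close> and \<open>y\<^sub>j\<close> as \<open>Inr j\<close>. Undirected graphs
  are symmetric digraphs.\<close>

definition bip_graph :: "'a::zero mat \<Rightarrow> (nat + nat) pair_pre_digraph" where
  "bip_graph M =
     \<lparr> pverts = Inl ` {..<dim_row M} \<union> Inr ` {..<dim_col M},
       parcs = {(Inl i, Inr j) | i j. (i, j) \<in> supp M} \<union> {(Inr j, Inl i) | i j. (i, j) \<in> supp M} \<rparr>"

text \<open>The constant \<open>forest\<close> of the graph library forbids all directed cycles, hence every edge of a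
  symmetric digraph, since an edge and its reverse form a cycle of length 2. The cycles of an
  undirected simple graph are those of length at least 3.\<close>

definition undirected_forest :: "'a pair_pre_digraph \<Rightarrow> bool" where
  "undirected_forest G \<longleftrightarrow> (\<nexists>p. pre_digraph.cycle (with_proj G) p \<and> length p \<ge> 3)"

definition partially_well_ordered_on :: "'a set \<Rightarrow> ('a \<Rightarrow> 'a \<Rightarrow> bool) \<Rightarrow> bool" where
  "partially_well_ordered_on A R \<longleftrightarrow>
     (\<nexists>B. B \<subseteq> A \<and> infinite B \<and> (\<forall>x \<in> B. \<forall>y \<in> B. x \<noteq> y \<longrightarrow> \<not> R x y)) \<and>
     (\<nexists>f :: nat \<Rightarrow> 'a. \<forall>n. f n \<in> A \<and> R (f (Suc n)) (f n) \<and> f (Suc n) \<noteq> f n)"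

end

theory Submission
  imports Defs "HOL-Library.Sublist" "HOL-Library.Infinite_Set"
begin

text \<open>
  Since \<open>G(M)\<close> is a forest, there are signs with \<open>M\<^bsub>k,l\<^esub> = r\<^sub>k c\<^sub>l\<close> on the support of \<open>M\<close>. Given a
  partitioned permutation matrix, order the points of the \<open>k\<close>-th row block by \<open>r\<^sub>k\<close> times the row index
  and the points of the \<open>l\<close>-th column block by \<open>c\<^sub>l\<close> times the column index. On a common cell the two
  orders agree, and as \<open>G(M)\<close> is a forest, all these orders have a common linear extension: remove
  a point lying in a leaf cell, and insert it again, which has to respect only one of its two orders.
  Replacing each point by its cell in this linear order gives a word over the finite alphabet of
  cells, from which the partitioned matrix can be recovered, and subwords correspond to smaller
  elements of \<open>Part(M)\<close>. So Higman's lemma rules out infinite antichains. A strictly smaller element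
  has fewer points, which rules out infinite descent.
\<close>

section \<open>Higman's lemma for finite alphabets\<close>

text \<open>Nash-Williams' minimal bad sequence argument. By the pigeonhole principle infinitely
  many words of a minimal bad sequence start with the same letter. Removing this letter from them,
  and dropping all other words from the first of them on, leaves a bad sequence that is
  smaller.\<close>

lemma higman_finite_alphabet:
  fixes w :: "nat \<Rightarrow> 'a list"
  assumes "finite A" and "\<And>n. set (w n) \<subseteq> A"
  shows "\<exists>i j. i < j \<and> subseq (w i) (w j)"
proof (rule ccontr)
  define bad where
    "bad f \<longleftrightarrow> (\<forall>n. set (f n) \<subseteq> A) \<and> (\<forall>i j. i < j \<longrightarrow> \<not> subseq (f i) (f j))" for f :: "nat \<Rightarrow> 'a list"
  assume "\<not> ?thesis"
  then have "bad w" using assms(2) by (auto simp: bad_def)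
  \<comment> \<open>Minimality at position \<open>n\<close>: no bad sequence with the same first
    \<open>n\<close> words has a shorter word there.\<close>
  define P where
    "P n f \<longleftrightarrow> bad f \<and> (\<forall>g. bad g \<longrightarrow> (\<forall>i<n. g i = f i) \<longrightarrow> length (f n) \<le> length (g n))"
    for n and f :: "nat \<Rightarrow> 'a list"
  have least: "\<exists>h. P n h \<and> (\<forall>i<n. h i = f i)" if f: "bad f" for f n
  proof -
    obtain h where "bad h \<and> (\<forall>i<n. h i = f i)"
      and "\<forall>g. bad g \<and> (\<forall>i<n. g i = f i) \<longrightarrow> length (h n) \<le> length (g n)"
      using ex_has_least_nat[of "\<lambda>g. bad g \<and> (\<forall>i<n. g i = f i)" f "\<lambda>g. length (g n)"] f
      by auto
    then show ?thesis by (auto simp: P_def intro!: exI[of _ h])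
  qed
  have "\<exists>F. \<forall>n. P n (F n) \<and> (\<forall>i\<le>n. F (Suc n) i = F n i)"
  proof (rule dependent_nat_choice)
    show "\<exists>f. P 0 f" using least[OF \<open>bad w\<close>] by blast
    show "\<exists>g. P (Suc n) g \<and> (\<forall>i\<le>n. g i = f i)" if "P n f" for f n
      using least[of f "Suc n"] that by (auto simp: P_def less_Suc_eq_le)
  qed
  then obtain F where F: "\<And>n. P n (F n)" "\<And>n i. i \<le> n \<Longrightarrow> F (Suc n) i = F n i" by blast
  \<comment> \<open>The diagonal of the successive minimal choices. As \<open>F n\<close> agrees
    with \<open>m\<close> up to position \<open>n\<close>, any two words of \<open>m\<close> already
    occur in one bad sequence.\<close>
  define m where "m n = F n n" for n
  have F_eq: "F n i = m i" if "i \<le> n" for n i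
    using that by (induction n rule: dec_induct) (auto simp: m_def F(2))
  have m: "set (m n) \<subseteq> A" for n using F(1)[of n] by (auto simp: P_def bad_def m_def)
  have not_sub: "\<not> subseq (m i) (m j)" if "i < j" for i j
    using F(1)[of j] that F_eq[of i j] F_eq[of j j] by (metis P_def bad_def less_imp_le order_refl)
  have ne: "m n \<noteq> []" for n using not_sub[of n "Suc n"] by auto
  have "finite (range (\<lambda>n. hd (m n)))"
    using m ne by (intro finite_subset[OF _ assms(1)]) (auto dest: hd_in_set)
  then obtain n0 where inf: "infinite {n. hd (m n) = hd (m n0)}"
    using pigeonhole_infinite[of UNIV "\<lambda>n. hd (m n)"] by auto
  \<comment> \<open>The positions, in increasing order, of the words of \<open>m\<close> that share
    one first letter.\<close>
  define \<phi> where "\<phi> = enumerate {n. hd (m n) = hd (m n0)}"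
  have \<phi>: "hd (m (\<phi> i)) = hd (m n0)" for i
    using enumerate_in_set[OF inf, of i] by (simp add: \<phi>_def)
  have \<phi>_mono: "\<phi> i < \<phi> j" if "i < j" for i j
    unfolding \<phi>_def by (rule enumerate_mono[OF that inf])
  have m_\<phi>: "m (\<phi> i) = hd (m n0) # tl (m (\<phi> i))" for i
    using ne[of "\<phi> i"] \<phi>[of i] by (metis list.collapse)
  \<comment> \<open>The smaller sequence: \<open>m\<close> is kept before position
    \<open>\<phi> 0\<close>, and from there on come the selected words without their common first
    letter.\<close>
  define g where "g i = (if i < \<phi> 0 then m i else tl (m (\<phi> (i - \<phi> 0))))" for i
  have "\<not> subseq (g i) (g j)" if "i < j" for i j
  proof
    assume sub: "subseq (g i) (g j)"
    consider "j < \<phi> 0" | "i < \<phi> 0" "\<phi> 0 \<le> j" | "\<phi> 0 \<le> i" by linarith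
    then show False
    proof cases
      case 1
      then show False using sub that not_sub by (auto simp: g_def)
    next
      case 2
      then have "subseq (m i) (tl (m (\<phi> (j - \<phi> 0))))" using sub by (simp add: g_def)
      then have "subseq (m i) (m (\<phi> (j - \<phi> 0)))" by (subst m_\<phi>) (rule list_emb_Cons)
      moreover have "\<phi> 0 \<le> \<phi> (j - \<phi> 0)" using \<phi>_mono[of 0] by (cases "j - \<phi> 0") (auto intro: less_imp_le)
      ultimately show False using 2 not_sub by (meson less_le_trans)
    next
      case 3
      then have "subseq (tl (m (\<phi> (i - \<phi> 0)))) (tl (m (\<phi> (j - \<phi> 0))))"
        using sub that by (simp add: g_def)
      then have "subseq (m (\<phi> (i - \<phi> 0))) (m (\<phi> (j - \<phi> 0)))"
        using m_\<phi> by (metis subseq_Cons2)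
      then show False using not_sub \<phi>_mono[of "i - \<phi> 0" "j - \<phi> 0"] 3 that by auto
    qed
  qed
  moreover have "set (tl (m n)) \<subseteq> A" for n using m[of n] by (cases "m n") auto
  then have "set (g i) \<subseteq> A" for i using m by (simp add: g_def)
  ultimately have "bad g" by (simp add: bad_def)
  \<comment> \<open>The sequence \<open>g\<close> competes with \<open>F (\<phi> 0)\<close> in the
    minimality at position \<open>\<phi> 0\<close>, where its word is one letter shorter.\<close>
  moreover have "\<forall>i<\<phi> 0. g i = F (\<phi> 0) i" by (simp add: g_def F_eq)
  ultimately have "length (F (\<phi> 0) (\<phi> 0)) \<le> length (g (\<phi> 0))"
    using F(1)[of "\<phi> 0"] by (auto simp: P_def)
  then show False
    using ne[of "\<phi> 0"] by (simp add: g_def F_eq Suc_le_eq flip: length_greater_0_conv)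
qed

section \<open>Leaves of forests\<close>

lemma pcas_map_upt:
  "pcas (v i) (map (\<lambda>n. (v n, v (Suc n))) [i..<i + d]) (v (i + d))"
proof (induction d arbitrary: i)
  case (Suc d)
  show ?case using Suc[of "Suc i"] by (simp add: upt_conv_Cons del: upt_Suc)
qed simp

lemma pawalk_verts_map_upt:
  "pawalk_verts (v i) (map (\<lambda>n. (v n, v (Suc n))) [i..<i + d]) = map v [i..<Suc (i + d)]"
proof (induction d arbitrary: i)
  case (Suc d)
  show ?case using Suc[of "Suc i"] by (simp add: upt_conv_Cons del: upt_Suc)
qed simp

text \<open>By \<open>ext\<close> a walk in \<open>E\<close> can be continued forever without
  turning back. As \<open>E\<close> is finite a vertex recurs, and the walk between the first
  recurrence and the earlier visit is a cycle.\<close>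

lemma cycle_if_nonbacktracking:
  fixes G :: "'a pair_pre_digraph"
  assumes "finite E" "E \<noteq> {}" "E \<subseteq> parcs G" "\<And>u v. (u, v) \<in> E \<Longrightarrow> u \<in> pverts G \<and> u \<noteq> v"
    and ext: "\<And>u v. (u, v) \<in> E \<Longrightarrow> \<exists>w. w \<noteq> u \<and> (v, w) \<in> E"
  shows "\<exists>p. pre_digraph.cycle (with_proj G) p \<and> length p \<ge> 3"
proof -
  have "\<exists>e. \<forall>n::nat. e n \<in> E \<and> (fst (e (Suc n)) = snd (e n) \<and> snd (e (Suc n)) \<noteq> fst (e n))"
  proof (rule dependent_nat_choice)
    show "\<exists>x. x \<in> E" using assms(2) by blast
    show "\<exists>y. y \<in> E \<and> (fst y = snd x \<and> snd y \<noteq> fst x)" if "x \<in> E" for x :: "'a \<times> 'a"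
      using ext[of "fst x" "snd x"] that by auto
  qed
  then obtain e where e: "\<And>n::nat. e n \<in> E" "\<And>n. fst (e (Suc n)) = snd (e n)"
    "\<And>n. snd (e (Suc n)) \<noteq> fst (e n)" by blast
  define v where "v n = fst (e n)" for n
  have e_eq: "e n = (v n, v (Suc n))" for n using e(2)[of n] by (simp add: v_def prod_eq_iff)
  have vE: "(v n, v (Suc n)) \<in> E" for n using e(1)[of n] e_eq by simp
  have nb: "v (Suc (Suc n)) \<noteq> v n" for n using e(2,3) by (metis v_def)
  have "finite (range v)"
    using e(1) by (intro finite_subset[OF _ finite_imageI[OF assms(1), of fst]]) (auto simp: v_def)
  then have "\<not> inj v" using finite_imageD by blast
  then have ex: "\<exists>j. \<exists>i<j. v i = v j" by (metis injI nat_neq_iff)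
  \<comment> \<open>The first time at which a vertex recurs, so that all vertices before time
    \<open>j\<close> are distinct.\<close>
  define j where "j = (LEAST j. \<exists>i<j. v i = v j)"
  obtain i where i: "i < j" "v i = v j" using LeastI_ex[OF ex] by (auto simp: j_def)
  have min: "v a \<noteq> v b" if "a < b" "b < j" for a b
    using not_less_Least[of b "\<lambda>j. \<exists>i<j. v i = v j"] that by (auto simp: j_def)
  \<comment> \<open>Recurrence after one step would be a loop, and after two steps it would be a
    return along the same edge.\<close>
  have "j \<noteq> Suc i" "j \<noteq> Suc (Suc i)" using vE[of i] assms(4) i nb[of i] by auto
  then have j3: "i + 3 \<le> j" using i by simp
  define p where "p = map (\<lambda>n. (v n, v (Suc n))) [i..<j]"
  have "pcas (v i) p (v i)" using pcas_map_upt[of v i "j - i"] i by (simp add: p_def)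
  moreover have "tl (pawalk_verts (v i) p) = map v [Suc i..<Suc j]"
    using pawalk_verts_map_upt[of v i "j - i"] i by (simp add: p_def upt_conv_Cons del: upt_Suc)
  moreover have "inj_on v {Suc i..<Suc j}"
    using i min by (intro linorder_inj_onI) (auto simp: less_Suc_eq, metis Suc_le_lessD)
  moreover have "set p \<subseteq> parcs G" "v i \<in> pverts G" using vE assms(3,4) by (auto simp: p_def)
  ultimately have "pre_digraph.cycle (with_proj G) p"
    using i unfolding pre_digraph.cycle_def pre_digraph.awalk_def
    by (intro exI[of _ "v i"]) (auto simp: cas_with_proj_eq awalk_verts_with_proj_eq distinct_map p_def simp del: upt_Suc)
  then show ?thesis using j3 by (intro exI[of _ p]) (auto simp: p_def)
qed

text \<open>For finite \<open>F\<close> this says that the bipartite graph with edge set \<open>F\<close> is a forest.\<close>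

definition leafy :: "('a \<times> 'b) set \<Rightarrow> bool" where
  "leafy F \<longleftrightarrow> (\<forall>F'\<subseteq>F. F' \<noteq> {} \<longrightarrow>
     (\<exists>(k, l)\<in>F'. (\<forall>l'. (k, l') \<in> F' \<longrightarrow> l' = l) \<or> (\<forall>k'. (k', l) \<in> F' \<longrightarrow> k' = k)))"

lemma leafyE:
  assumes "leafy F" "F' \<subseteq> F" "F' \<noteq> {}"
  obtains k l where "(k, l) \<in> F'"
    "(\<forall>l'. (k, l') \<in> F' \<longrightarrow> l' = l) \<or> (\<forall>k'. (k', l) \<in> F' \<longrightarrow> k' = k)"
  using assms unfolding leafy_def by blast

lemma leafy_subset: "leafy F \<Longrightarrow> F' \<subseteq> F \<Longrightarrow> leafy F'"
  unfolding leafy_def by (meson order_trans)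

lemma finite_supp: "finite (supp Q)"
  by (rule finite_subset[of _ "{..<dim_row Q} \<times> {..<dim_col Q}"]) (auto simp: supp_def)

text \<open>If a nonempty edge set has no leaf edge, every edge can be continued at both of its ends
  by another edge. Its edges, taken in both orientations, then satisfy the conditions for a
  non-backtracking walk, which closes up to a cycle.\<close>

lemma leafy_if_undirected_forest:
  assumes "undirected_forest (bip_graph M)"
  shows "leafy (supp M)"
  unfolding leafy_def
proof (intro allI impI, rule ccontr)
  fix F assume F: "F \<subseteq> supp M" "F \<noteq> {}"
    and no_leaf: "\<not> (\<exists>(k, l)\<in>F. (\<forall>l'. (k, l') \<in> F \<longrightarrow> l' = l) \<or> (\<forall>k'. (k', l) \<in> F \<longrightarrow> k' = k))"
  have ext1: "\<exists>l'. (k, l') \<in> F \<and> l' \<noteq> l" and ext2: "\<exists>k'. (k', l) \<in> F \<and> k' \<noteq> k"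
    if "(k, l) \<in> F" for k l using no_leaf that by blast+
  define E :: "((nat + nat) \<times> (nat + nat)) set"
    where "E = (\<lambda>(k, l). (Inl k, Inr l)) ` F \<union> (\<lambda>(k, l). (Inr l, Inl k)) ` F"
  have "\<exists>p. pre_digraph.cycle (with_proj (bip_graph M)) p \<and> length p \<ge> 3"
  proof (rule cycle_if_nonbacktracking[of E])
    show "finite E" using finite_subset[OF F(1) finite_supp] by (simp add: E_def)
    show "E \<noteq> {}" using F(2) by (simp add: E_def)
    show "E \<subseteq> parcs (bip_graph M)" using F(1) by (auto simp: E_def bip_graph_def)
    show "u \<in> pverts (bip_graph M) \<and> u \<noteq> v" if "(u, v) \<in> E" for u v
      using that F(1) by (auto simp: E_def bip_graph_def supp_def)
    show "\<exists>w. w \<noteq> u \<and> (v, w) \<in> E" if arc: "(u, v) \<in> E" for u v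
    proof -
      obtain k l where kl: "(k, l) \<in> F" and uv: "u = Inl k \<and> v = Inr l \<or> u = Inr l \<and> v = Inl k"
        using arc by (auto simp: E_def)
      obtain k' l' where "(k', l) \<in> F" "k' \<noteq> k" "(k, l') \<in> F" "l' \<noteq> l"
        using ext1[OF kl] ext2[OF kl] by blast
      then have "(Inr l, Inl k') \<in> E" "(Inl k, Inr l') \<in> E" "Inl k' \<noteq> (Inl k :: nat + nat)"
        "Inr l' \<noteq> (Inr l :: nat + nat)" by (force simp: E_def)+
      then show ?thesis using uv by blast
    qed
  qed
  then show False using assms by (auto simp: undirected_forest_def)
qed

text \<open>Induction on the number of edges: remove a leaf edge and sign the rest. One end of the
  leaf edge lies on no other edge, so its sign can be changed freely.\<close>

lemma leafy_sign_assignment: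
  fixes s :: "'a \<times> 'b \<Rightarrow> int"
  assumes "finite F" "leafy F" "\<And>e. e \<in> F \<Longrightarrow> s e \<in> {1, -1}"
  shows "\<exists>r c. (\<forall>k. r k \<in> {1, -1}) \<and> (\<forall>l. c l \<in> {1, -1}) \<and> (\<forall>(k, l)\<in>F. s (k, l) = r k * c l)"
  using assms
proof (induction F rule: finite_psubset_induct)
  case (psubset F)
  show ?case
  proof (cases "F = {}")
    case True
    then show ?thesis by (intro exI[of _ "\<lambda>_. 1"]) auto
  next
    case False
    then obtain k l where kl: "(k, l) \<in> F"
      and leaf: "(\<forall>l'. (k, l') \<in> F \<longrightarrow> l' = l) \<or> (\<forall>k'. (k', l) \<in> F \<longrightarrow> k' = k)"
      using leafyE[OF psubset.prems(1), of F] by auto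
    have "\<exists>r c. (\<forall>k. r k \<in> {1, -1}) \<and> (\<forall>l. c l \<in> {1, -1}) \<and>
        (\<forall>(k, l)\<in>F - {(k, l)}. s (k, l) = r k * c l)"
      using kl psubset.prems by (intro psubset.IH) (auto intro: leafy_subset[OF psubset.prems(1)])
    then obtain r c where rc: "\<And>k. r k \<in> {1, -1}" "\<And>l. c l \<in> {1, -1}"
      "\<And>k' l'. (k', l') \<in> F \<Longrightarrow> (k', l') \<noteq> (k, l) \<Longrightarrow> s (k', l') = r k' * c l'" by blast
    have skl: "s (k, l) \<in> {1, -1}" using psubset.prems(2) kl by blast
    \<comment> \<open>A sign is its own inverse, so the free sign at one end of the leaf edge is
      \<open>s (k, l)\<close> times the sign at the other end.\<close>
    have cc: "c l * c l = 1" "r k * r k = 1" using rc(1)[of k] rc(2)[of l] by auto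
    from leaf show ?thesis
    proof
      assume *: "\<forall>l'. (k, l') \<in> F \<longrightarrow> l' = l"
      let ?r = "r(k := s (k, l) * c l)"
      have "\<forall>k. ?r k \<in> {1, -1}" using rc(1) rc(2)[of l] skl by auto
      moreover have "\<forall>(k', l')\<in>F. s (k', l') = ?r k' * c l'" using * rc(3) cc by (auto simp: mult.assoc)
      ultimately show ?thesis using rc(2) by blast
    next
      assume *: "\<forall>k'. (k', l) \<in> F \<longrightarrow> k' = k"
      let ?c = "c(l := s (k, l) * r k)"
      have "\<forall>l. ?c l \<in> {1, -1}" using rc(2) rc(1)[of k] skl by auto
      moreover have "\<forall>(k', l')\<in>F. s (k', l') = r k' * ?c l'" using * rc(3) cc by (auto simp: mult.left_commute)
      ultimately show ?thesis using rc(1) by blast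
    qed
  qed
qed

section \<open>Common linear extensions along a forest\<close>

text \<open>By \<open>leaf\<close> the elements in the \<open>C\<close>-class of \<open>p\<close>
  are also in its \<open>R\<close>-class, and there \<open>agree\<close> makes comparison with
  \<open>p\<close> by \<open>g\<close> the same as by \<open>f\<close>. So it suffices to respect
  \<open>f\<close> on the \<open>R\<close>-class of \<open>p\<close>.\<close>

lemma insert_leaf_point:
  fixes f g :: "'a \<Rightarrow> int"
  assumes leaf: "\<And>q. q \<in> set xs \<Longrightarrow> C q = C p \<Longrightarrow> R q = R p"
    and agree: "\<And>q. q \<in> set xs \<Longrightarrow> R q = R p \<Longrightarrow> C q = C p \<Longrightarrow>
      (f q < f p \<longleftrightarrow> g q < g p) \<and> (f p < f q \<longleftrightarrow> g p < g q)"
    and inj: "\<And>q. q \<in> set xs \<Longrightarrow> f q \<noteq> f p"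
    and "p \<notin> set xs" "distinct xs"
    and sorted: "sorted_wrt (\<lambda>p q. (R p = R q \<longrightarrow> f p < f q) \<and> (C p = C q \<longrightarrow> g p < g q)) xs"
  shows "\<exists>ys. distinct ys \<and> set ys = insert p (set xs) \<and>
    sorted_wrt (\<lambda>p q. (R p = R q \<longrightarrow> f p < f q) \<and> (C p = C q \<longrightarrow> g p < g q)) ys"
proof -
  let ?Q = "\<lambda>p q. (R p = R q \<longrightarrow> f p < f q) \<and> (C p = C q \<longrightarrow> g p < g q)"
  \<comment> \<open>The predicate fails exactly at the elements that have to come after
    \<open>p\<close>; the new element goes just before the first of them, or to the end if there is
    none.\<close>
  define T where "T q \<longleftrightarrow> \<not> (R q = R p \<and> f p < f q)" for q
  define as bs where "as = takeWhile T xs" and "bs = dropWhile T xs"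
  have xs: "xs = as @ bs" by (simp add: as_def bs_def)
  have as: "?Q q p" if "q \<in> set as" for q
  proof -
    have "q \<in> set xs" "T q" using that by (auto simp: as_def dest: set_takeWhileD)
    then show ?thesis using leaf[of q] agree[of q] inj[of q] by (auto simp: T_def)
  qed
  have bs: "?Q p q" if q: "q \<in> set bs" for q
  proof -
    \<comment> \<open>The first element \<open>b\<close> after the insertion point has
      \<open>f p < f b\<close>; elements of the same \<open>R\<close>-class further right have still
      larger values, as \<open>xs\<close> is sorted.\<close>
    obtain b bs' where b: "bs = b # bs'" using q by (cases bs) auto
    then have "\<not> T b" by (metis bs_def dropWhile_eq_Cons_conv)
    moreover have "q = b \<or> ?Q b q" using that sorted by (auto simp: xs b sorted_wrt_append)
    ultimately have "R q = R p \<longrightarrow> f p < f q" by (auto simp: T_def)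
    then show ?thesis using leaf[of q] agree[of q] that by (auto simp: xs)
  qed
  have "sorted_wrt ?Q (as @ p # bs)"
    using sorted as bs unfolding xs sorted_wrt_append by auto
  moreover have "distinct (as @ p # bs)" "set (as @ p # bs) = insert p (set xs)"
    using assms(4,5) by (auto simp: xs)
  ultimately show ?thesis by blast
qed

lemma leafy_common_linear_extension:
  fixes f g :: "'a \<Rightarrow> int"
  assumes "finite S" "leafy ((\<lambda>p. (R p, C p)) ` S)" "inj_on f S" "inj_on g S"
    and "\<And>p q. p \<in> S \<Longrightarrow> q \<in> S \<Longrightarrow> R p = R q \<Longrightarrow> C p = C q \<Longrightarrow> f p < f q \<longleftrightarrow> g p < g q"
  shows "\<exists>xs. distinct xs \<and> set xs = S \<and>
    sorted_wrt (\<lambda>p q. (R p = R q \<longrightarrow> f p < f q) \<and> (C p = C q \<longrightarrow> g p < g q)) xs"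
  using assms
proof (induction S rule: finite_psubset_induct)
  case (psubset S)
  show ?case
  proof (cases "S = {}")
    case False
    then have "(\<lambda>p. (R p, C p)) ` S \<noteq> {}" by simp
    then obtain k l where kl: "(k, l) \<in> (\<lambda>p. (R p, C p)) ` S"
      and leaf_kl: "(\<forall>l'. (k, l') \<in> (\<lambda>p. (R p, C p)) ` S \<longrightarrow> l' = l) \<or>
        (\<forall>k'. (k', l) \<in> (\<lambda>p. (R p, C p)) ` S \<longrightarrow> k' = k)"
      by (rule leafyE[OF psubset.prems(1) order_refl])
    obtain p where p: "p \<in> S" "k = R p" "l = C p" using kl by auto
    have mem: "(R q, C q) \<in> (\<lambda>p. (R p, C p)) ` S" if "q \<in> S" for q using that by simp
    have leaf: "(\<forall>q\<in>S. R q = R p \<longrightarrow> C q = C p) \<or> (\<forall>q\<in>S. C q = C p \<longrightarrow> R q = R p)"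
      using leaf_kl mem unfolding p(2,3) by metis
    have "\<exists>xs. distinct xs \<and> set xs = S - {p} \<and>
      sorted_wrt (\<lambda>p q. (R p = R q \<longrightarrow> f p < f q) \<and> (C p = C q \<longrightarrow> g p < g q)) xs"
    proof (rule psubset.IH)
      show "S - {p} \<subset> S" using p(1) by blast
      show "leafy ((\<lambda>p. (R p, C p)) ` (S - {p}))"
        by (rule leafy_subset[OF psubset.prems(1)]) blast
      show "inj_on f (S - {p})" by (rule inj_on_subset[OF psubset.prems(2)]) blast
      show "inj_on g (S - {p})" by (rule inj_on_subset[OF psubset.prems(3)]) blast
    qed (simp add: psubset.prems(4))
    then obtain xs where xs: "distinct xs" "set xs = S - {p}"
      "sorted_wrt (\<lambda>p q. (R p = R q \<longrightarrow> f p < f q) \<and> (C p = C q \<longrightarrow> g p < g q)) xs"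
      by blast
    have S: "S = insert p (set xs)" "p \<notin> set xs" using xs(2) p by auto
    have neq: "f q \<noteq> f p" "g q \<noteq> g p" if "q \<in> set xs" for q
      using that S psubset.prems(2,3) by (auto simp: inj_on_def)
    have mem_S: "q \<in> S" if "q \<in> set xs" for q using that xs(2) by simp
    have agree: "(f q < f p \<longleftrightarrow> g q < g p) \<and> (f p < f q \<longleftrightarrow> g p < g q)"
      if "q \<in> set xs" "R q = R p" "C q = C p" for q
      using psubset.prems(4)[OF mem_S[OF that(1)] p(1) that(2,3)]
        psubset.prems(4)[OF p(1) mem_S[OF that(1)]] that by simp
    from leaf show ?thesis
    proof
      assume *: "\<forall>q\<in>S. C q = C p \<longrightarrow> R q = R p"
      show ?thesis
        unfolding S(1) using * mem_S agree neq(1) S(2) xs(1,3) by (intro insert_leaf_point) blast+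
    next
      assume *: "\<forall>q\<in>S. R q = R p \<longrightarrow> C q = C p"
      \<comment> \<open>The other kind of leaf: the same insertion with the roles of
        \<open>R\<close>, \<open>f\<close> and \<open>C\<close>, \<open>g\<close> exchanged.\<close>
      have "\<exists>ys. distinct ys \<and> set ys = insert p (set xs) \<and>
        sorted_wrt (\<lambda>p q. (C p = C q \<longrightarrow> g p < g q) \<and> (R p = R q \<longrightarrow> f p < f q)) ys"
      proof (rule insert_leaf_point)
        show "sorted_wrt (\<lambda>p q. (C p = C q \<longrightarrow> g p < g q) \<and> (R p = R q \<longrightarrow> f p < f q)) xs"
          using xs(3) by (simp add: conj_commute)
      qed (use * mem_S agree neq(2) S(2) xs(1) in blast)+
      then show ?thesis unfolding S(1) by (simp add: conj_commute)
    qed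
  qed simp
qed

section \<open>Permutation matrices and their submatrices\<close>

lemma supp_permutation_matrix:
  assumes "permutation_matrix P"
  shows "(i, j) \<in> supp P \<longleftrightarrow> i < dim_row P \<and> j < dim_row P \<and> P $$ (i, j) = 1"
proof -
  have "dim_col P = dim_row P" and "elements_mat P \<subseteq> {0, 1}"
    using assms by (auto simp: permutation_matrix_def)
  moreover have "P $$ (i, j) \<in> elements_mat P" if "i < dim_row P" "j < dim_col P"
    using that by blast
  ultimately show ?thesis by (auto simp: supp_def)
qed

lemma dim_col_permutation_matrix: "permutation_matrix P \<Longrightarrow> dim_col P = dim_row P"
  by (simp add: permutation_matrix_def)

lemma permutation_matrix_rows:
  assumes "permutation_matrix P"
  shows "inj_on fst (supp P)" and "fst ` supp P = {..<dim_row P}"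
proof -
  have "\<forall>i<dim_row P. \<exists>!j. j < dim_col P \<and> P $$ (i, j) = 1"
    using assms unfolding permutation_matrix_def by blast
  then have ex1: "\<exists>!j. (i, j) \<in> supp P" if "i < dim_row P" for i
    using that by (simp add: supp_permutation_matrix[OF assms] dim_col_permutation_matrix[OF assms])
  have less: "i < dim_row P" if "(i, j) \<in> supp P" for i j
    using that by (auto simp: supp_def)
  show "inj_on fst (supp P)" using ex1 less by (auto simp: inj_on_def) blast
  show "fst ` supp P = {..<dim_row P}" using ex1 less by (force simp: image_iff)
qed

lemma permutation_matrix_cols:
  assumes "permutation_matrix P"
  shows "inj_on snd (supp P)" and "snd ` supp P = {..<dim_row P}"
proof -
  have "\<forall>j<dim_col P. \<exists>!i. i < dim_row P \<and> P $$ (i, j) = 1"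
    using assms unfolding permutation_matrix_def by blast
  then have ex1: "\<exists>!i. (i, j) \<in> supp P" if "j < dim_row P" for j
    using that by (simp add: supp_permutation_matrix[OF assms] dim_col_permutation_matrix[OF assms])
  have less: "j < dim_row P" if "(i, j) \<in> supp P" for i j
    using that dim_col_permutation_matrix[OF assms] by (auto simp: supp_def)
  show "inj_on snd (supp P)" using ex1 less by (auto simp: inj_on_def) blast
  show "snd ` supp P = {..<dim_row P}" using ex1 less by (force simp: image_iff)
qed

text \<open>As \<open>f\<close> numbers \<open>S\<close> by 0, ..., n-1, the value
  \<open>f p\<close> is the number of elements of \<open>S\<close> that precede \<open>p\<close>.
  Since \<open>g\<close> orders \<open>S\<close> in the same way, this is also the rank of
  \<open>g p\<close> in the image of \<open>g\<close>, and \<open>pick\<close> turns a rank back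
  into the element.\<close>

lemma pick_image:
  fixes f g :: "'a \<Rightarrow> nat"
  assumes "inj_on f S" "f ` S = {..<n}"
    and order: "\<And>p q. p \<in> S \<Longrightarrow> q \<in> S \<Longrightarrow> f p < f q \<longleftrightarrow> g p < g q"
  shows "inj_on g S" and "card (g ` S) = n" and "p \<in> S \<Longrightarrow> pick (g ` S) (f p) = g p"
proof -
  show inj: "inj_on g S"
    using order assms(1) unfolding inj_on_def by (metis less_irrefl linorder_neqE_nat)
  show "card (g ` S) = n"
    using card_image[OF inj] card_image[OF assms(1)] assms(2) by simp
  assume p: "p \<in> S"
  have "{a \<in> g ` S. a < g p} = g ` {q \<in> S. f q < f p}" using order p by auto
  then have "card {a \<in> g ` S. a < g p} = card {q \<in> S. f q < f p}"
    using card_image[OF inj_on_subset[OF inj]] by simp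
  also have "\<dots> = card (f ` {q \<in> S. f q < f p})"
    by (rule card_image[OF inj_on_subset[OF assms(1)], symmetric]) auto
  also have "f ` {q \<in> S. f q < f p} = {..<f p}"
  proof -
    have "f p < n" using assms(2) p by auto
    then have "\<exists>q\<in>S. f q = x" if "x < f p" for x
      using that assms(2) by (metis imageE lessThan_iff less_trans)
    then show ?thesis by auto
  qed
  finally show "pick (g ` S) (f p) = g p"
    using pick_card_in_set[of "g p" "g ` S"] p by simp
qed

lemma red_delta_mat:
  assumes "finite X"
  shows "dim_row (red (delta_mat X)) = card (fst ` X)"
    and "dim_col (red (delta_mat X)) = card (snd ` X)"
    and "i < card (fst ` X) \<Longrightarrow> j < card (snd ` X) \<Longrightarrow>
      red (delta_mat X) $$ (i, j) = (if (pick (fst ` X) i, pick (snd ` X) j) \<in> X then 1 else 0)"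
proof -
  let ?D = "delta_mat X"
  have red: "red ?D = submatrix ?D (fst ` X) (snd ` X)"
    unfolding red_def supp_delta_mat[OF assms] by (rule arg_cong2[of _ _ _ _ "submatrix ?D"]) force+
  have sub: "i < dim_row ?D \<and> j < dim_col ?D" if "(i, j) \<in> X" for i j
    using that supp_delta_mat[OF assms] by (auto simp: supp_def)
  have R: "{i. i < dim_row ?D \<and> i \<in> fst ` X} = fst ` X"
    and C: "{j. j < dim_col ?D \<and> j \<in> snd ` X} = snd ` X" using sub by auto
  show "dim_row (red ?D) = card (fst ` X)" "dim_col (red ?D) = card (snd ` X)"
    unfolding red dim_submatrix R C by simp_all
  assume ij: "i < card (fst ` X)" "j < card (snd ` X)"
  then have "red ?D $$ (i, j) = ?D $$ (pick (fst ` X) i, pick (snd ` X) j)"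
    unfolding red by (intro submatrix_index) (simp_all add: R C)
  moreover have "pick (fst ` X) i \<in> fst ` X" "pick (snd ` X) j \<in> snd ` X"
    using ij by (auto intro: pick_in_set_le)
  then have "pick (fst ` X) i < dim_row ?D" "pick (snd ` X) j < dim_col ?D" using R C by auto
  ultimately show "red ?D $$ (i, j) = (if (pick (fst ` X) i, pick (snd ` X) j) \<in> X then 1 else 0)"
    by (simp add: delta_mat_def)
qed

text \<open>A copy of the support that keeps the relative order of rows and that of columns reduces
  to the original matrix: the ranks of the rows and columns of \<open>h p\<close> are the
  coordinates of \<open>p\<close>.\<close>

lemma red_delta_mat_image:
  assumes perm: "permutation_matrix P"
    and rows: "\<And>p q. p \<in> supp P \<Longrightarrow> q \<in> supp P \<Longrightarrow> fst p < fst q \<longleftrightarrow> fst (h p) < fst (h q)"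
    and cols: "\<And>p q. p \<in> supp P \<Longrightarrow> q \<in> supp P \<Longrightarrow> snd p < snd q \<longleftrightarrow> snd (h p) < snd (h q)"
  shows "red (delta_mat (h ` supp P)) = P"
proof -
  let ?X = "h ` supp P"
  have fin: "finite ?X" by (simp add: finite_supp)
  note R = pick_image[OF permutation_matrix_rows[OF perm], of "\<lambda>p. fst (h p)", OF rows]
  note C = pick_image[OF permutation_matrix_cols[OF perm], of "\<lambda>p. snd (h p)", OF cols]
  have im: "fst ` ?X = (\<lambda>p. fst (h p)) ` supp P" "snd ` ?X = (\<lambda>p. snd (h p)) ` supp P"
    by (simp_all add: image_image)
  show ?thesis
  proof (rule eq_matI)
    show "dim_row (red (delta_mat ?X)) = dim_row P"
      using R(2) by (simp add: red_delta_mat[OF fin] im)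
    show "dim_col (red (delta_mat ?X)) = dim_col P"
      using C(2) by (simp add: red_delta_mat[OF fin] im dim_col_permutation_matrix[OF perm])
    fix i j assume "i < dim_row P" "j < dim_col P"
    then have ij: "i < dim_row P" "j < dim_row P" by (simp_all add: dim_col_permutation_matrix[OF perm])
    obtain p where p: "p \<in> supp P" "fst p = i"
      using ij permutation_matrix_rows(2)[OF perm] by (metis imageE lessThan_iff)
    obtain q where q: "q \<in> supp P" "snd q = j"
      using ij permutation_matrix_cols(2)[OF perm] by (metis imageE lessThan_iff)
    have "red (delta_mat ?X) $$ (i, j) = (if (pick (fst ` ?X) i, pick (snd ` ?X) j) \<in> ?X then 1 else 0)"
      using ij R(2) C(2) by (intro red_delta_mat(3)[OF fin]) (simp_all add: im)
    also have "(pick (fst ` ?X) i, pick (snd ` ?X) j) = (fst (h p), snd (h q))"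
      using R(3)[OF _ _ p(1)] C(3)[OF _ _ q(1)] p(2) q(2) by (simp add: im)
    \<comment> \<open>A point of the copy in the row of \<open>h p\<close> and the column of
      \<open>h q\<close> must come from \<open>p\<close> and from \<open>q\<close>, as rows and
      columns of the copy are distinct.\<close>
    also have "(fst (h p), snd (h q)) \<in> ?X \<longleftrightarrow> p = q"
    proof
      assume "(fst (h p), snd (h q)) \<in> ?X"
      then obtain z where z: "z \<in> supp P" "h z = (fst (h p), snd (h q))" by auto
      then have "z = p" "z = q" using R(1) C(1) p q by (auto simp: inj_on_def)
      then show "p = q" by simp
    qed (use p in \<open>auto simp: image_iff intro!: bexI[of _ p]\<close>)
    also have "p = q \<longleftrightarrow> (i, j) \<in> supp P"
      using p q permutation_matrix_rows(1)[OF perm] permutation_matrix_cols(1)[OF perm]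
      by (metis fst_conv inj_onD prod.collapse snd_conv)
    also have "(if (i, j) \<in> supp P then 1 else 0) = P $$ (i, j)"
      using ij supp_permutation_matrix[OF perm, of i j]
      by (auto simp: supp_def dim_col_permutation_matrix[OF perm])
    finally show "red (delta_mat ?X) $$ (i, j) = P $$ (i, j)" .
  qed
qed

section \<open>Blocks of a division and cells of a partition\<close>

definition block :: "nat list \<Rightarrow> nat \<Rightarrow> nat" where
  "block I i = (LEAST k. i < I ! (k + 1))"

lemma division_mono: "division m n I \<Longrightarrow> k \<le> k' \<Longrightarrow> k' \<le> m \<Longrightarrow> I ! k \<le> I ! k'"
  by (auto simp: division_def intro!: sorted_nth_mono)

text \<open>The last end point \<open>n\<close> exceeds \<open>i\<close>, so the
  \<open>LEAST\<close> in \<open>block\<close> exists. Its minimality puts the left end point at or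
  below \<open>i\<close>, so that empty intervals coming from repeated end points are never
  chosen.\<close>

lemma block_in_interval:
  assumes "division m n I" "i < n"
  shows "block I i < m" and "i \<in> part_interval I (block I i)"
proof -
  have "m \<noteq> 0" using assms by (metis division_def less_nat_zero_code)
  then have m: "i < I ! ((m - 1) + 1)" using assms by (simp add: division_def)
  have "block I i \<le> m - 1" unfolding block_def by (rule Least_le[of "\<lambda>k. i < I ! (k + 1)", OF m])
  then show "block I i < m" using \<open>m \<noteq> 0\<close> by simp
  have "i < I ! (block I i + 1)" unfolding block_def by (rule LeastI[of "\<lambda>k. i < I ! (k + 1)", OF m])
  moreover have "I ! block I i \<le> i"
  proof (cases "block I i")
    case 0
    then show ?thesis using assms by (simp add: division_def)
  next
    case (Suc k)
    then have "k < (LEAST k. i < I ! (k + 1))" by (simp add: block_def)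
    from not_less_Least[OF this] Suc show ?thesis by simp
  qed
  ultimately show "i \<in> part_interval I (block I i)" by simp
qed

lemma block_eq:
  assumes "division m n I" "k < m" "i \<in> part_interval I k"
  shows "block I i = k"
  unfolding block_def
proof (rule Least_equality)
  show "i < I ! (k + 1)" using assms by simp
  show "k \<le> k'" if "i < I ! (k' + 1)" for k'
  proof (rule ccontr)
    assume "\<not> k \<le> k'"
    then have "I ! (k' + 1) \<le> I ! k" using assms by (intro division_mono) auto
    then show False using that assms by simp
  qed
qed

lemma block_less:
  assumes "division m n I" "i < n" "i' < n" "block I i < block I i'"
  shows "i < i'"
proof -
  have "I ! (block I i + 1) \<le> I ! block I i'"
    using assms block_in_interval(1)[OF assms(1,3)] by (intro division_mono[OF assms(1)]) auto
  then show ?thesis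
    using block_in_interval(2)[OF assms(1,2)] block_in_interval(2)[OF assms(1,3)] by simp
qed

lemma card_less_iff:
  fixes i i' :: nat
  assumes "i \<in> S"
  shows "card {a \<in> S. a < i} < card {a \<in> S. a < i'} \<longleftrightarrow> i < i'"
proof
  assume "i < i'"
  then show "card {a \<in> S. a < i} < card {a \<in> S. a < i'}"
    using assms by (intro psubset_card_mono) (auto simp: psubset_eq)
next
  assume less: "card {a \<in> S. a < i} < card {a \<in> S. a < i'}"
  show "i < i'"
  proof (rule ccontr)
    assume "\<not> i < i'"
    then have "card {a \<in> S. a < i'} \<le> card {a \<in> S. a < i}" by (intro card_mono) auto
    then show False using less by simp
  qed
qed

lemma supp_submatrixI:
  assumes "(i, j) \<in> supp A" "i \<in> S" "j \<in> T"
  shows "(card {a \<in> S. a < i}, card {a \<in> T. a < j}) \<in> supp (submatrix A S T)"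
proof -
  have ij: "i < dim_row A" "j < dim_col A" "A $$ (i, j) \<noteq> 0" using assms(1) by (auto simp: supp_def)
  \<comment> \<open>The rank of a row in \<open>S\<close> is its index in the submatrix. Comparing
    \<open>i\<close> with \<open>dim_row A\<close> and \<open>j\<close> with
    \<open>dim_col A\<close> shows that the two ranks are within the dimensions of the
    submatrix.\<close>
  then show ?thesis
    using submatrix_index_card[of i A j S T] assms card_less_iff[of i S "dim_row A"]
      card_less_iff[of j T "dim_col A"]
    by (auto simp: supp_def dim_submatrix set_le_in)
qed

text \<open>Translates the conditions on submatrices into conditions on points of \<open>P\<close>,
  using that ranks preserve order. Taking \<open>q = p\<close> shows that every occupied cell lies
  in \<open>supp M\<close>.\<close>

lemma M_partition_cell:
  assumes "M_partition M P I J" "p \<in> supp P" "q \<in> supp P"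
    and eq: "block I (fst p) = block I (fst q)" "block J (snd p) = block J (snd q)"
  defines "e \<equiv> (block I (fst p), block J (snd p))"
  shows "e \<in> supp M"
    and "M $$ e = 1 \<Longrightarrow> fst p < fst q \<Longrightarrow> snd p < snd q"
    and "M $$ e = -1 \<Longrightarrow> fst p < fst q \<Longrightarrow> snd q < snd p"
proof -
  let ?S = "part_interval I (fst e)" and ?T = "part_interval J (snd e)"
  let ?Q = "submatrix P ?S ?T"
  let ?r = "\<lambda>i. card {a \<in> ?S. a < i}" and ?c = "\<lambda>j. card {a \<in> ?T. a < j}"
  have div: "division (dim_row M) (dim_row P) I" "division (dim_col M) (dim_col P) J"
    using assms(1) by (auto simp: M_partition_def)
  have dims: "fst p < dim_row P" "fst q < dim_row P" "snd p < dim_col P" "snd q < dim_col P"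
    using assms(2,3) by (auto simp: supp_def)
  have e: "fst e < dim_row M" "snd e < dim_col M"
    using block_in_interval(1)[OF div(1) dims(1)] block_in_interval(1)[OF div(2) dims(3)]
    by (simp_all add: e_def)
  have Q: "M $$ e = 0 \<Longrightarrow> ?Q = 0\<^sub>m (dim_row ?Q) (dim_col ?Q)"
    "M $$ e = 1 \<Longrightarrow> increasing_mat ?Q" "M $$ e = -1 \<Longrightarrow> decreasing_mat ?Q"
    using assms(1) e by (auto simp: M_partition_def Let_def)
  have p: "fst p \<in> ?S" "snd p \<in> ?T"
    using block_in_interval(2)[OF div(1) dims(1)] block_in_interval(2)[OF div(2) dims(3)]
    by (simp_all add: e_def)
  have q: "fst q \<in> ?S" "snd q \<in> ?T"
    using block_in_interval(2)[OF div(1) dims(2)] block_in_interval(2)[OF div(2) dims(4)]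
    by (simp_all add: e_def eq)
  have pQ: "(?r (fst p), ?c (snd p)) \<in> supp ?Q" and qQ: "(?r (fst q), ?c (snd q)) \<in> supp ?Q"
    using supp_submatrixI[of "fst p" "snd p" P] supp_submatrixI[of "fst q" "snd q" P] assms(2,3) p q
    by (simp_all only: prod.collapse)
  have "M $$ e \<noteq> 0"
  proof
    assume "M $$ e = 0"
    have "supp ?Q = {}" by (subst Q(1)[OF \<open>M $$ e = 0\<close>]) (auto simp: supp_def)
    with pQ show False by blast
  qed
  then show "e \<in> supp M" using e by (simp add: supp_def split_beta)
  show "snd p < snd q" if "M $$ e = 1" "fst p < fst q"
  proof -
    have "?r (fst p) < ?r (fst q)" using that(2) card_less_iff[OF p(1)] by simp
    then have "?c (snd p) < ?c (snd q)"
      using Q(2)[OF that(1)] pQ qQ unfolding increasing_mat_def by blast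
    then show ?thesis using card_less_iff[OF p(2)] by simp
  qed
  show "snd q < snd p" if "M $$ e = -1" "fst p < fst q"
  proof -
    have "?r (fst p) < ?r (fst q)" using that(2) card_less_iff[OF p(1)] by simp
    then have "?c (snd q) < ?c (snd p)"
      using Q(3)[OF that(1)] pQ qQ unfolding decreasing_mat_def by blast
    then show ?thesis using card_less_iff[OF q(2)] by simp
  qed
qed

section \<open>Words of cells\<close>

text \<open>The sign is a factor so that one strict inequality covers both directions in which a
  block may be read.\<close>

definition adapted ::
  "(nat \<Rightarrow> int) \<Rightarrow> (nat \<Rightarrow> int) \<Rightarrow> nat list \<Rightarrow> nat list \<Rightarrow> (nat \<times> nat) list \<Rightarrow> bool" where
  "adapted r c I J = sorted_wrt (\<lambda>p q.
     (block I (fst p) = block I (fst q) \<longrightarrow>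
        r (block I (fst p)) * int (fst p) < r (block I (fst q)) * int (fst q)) \<and>
     (block J (snd p) = block J (snd q) \<longrightarrow>
        c (block J (snd p)) * int (snd p) < c (block J (snd q)) * int (snd q)))"

text \<open>The two signed orders agree on each cell: for entry 1 the signs are equal and columns
  grow with rows, for entry -1 the signs are opposite and columns fall as rows grow. Occupied cells
  lie in \<open>supp M\<close>, so they inherit the forest property.\<close>

lemma ex_adapted:
  assumes "leafy (supp M)" and perm: "permutation_matrix P" and part: "M_partition M P I J"
    and r: "\<And>k. r k \<in> {1, -1}" and c: "\<And>l. c l \<in> {1, -1}"
    and rc: "\<And>k l. (k, l) \<in> supp M \<Longrightarrow> M $$ (k, l) = r k * c l"
  shows "\<exists>xs. distinct xs \<and> set xs = supp P \<and> adapted r c I J xs"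
  unfolding adapted_def
proof (rule leafy_common_linear_extension)
  show "finite (supp P)" by (rule finite_supp)
  show "leafy ((\<lambda>p. (block I (fst p), block J (snd p))) ` supp P)"
    using M_partition_cell(1)[OF part _ _ refl refl] by (intro leafy_subset[OF assms(1)]) auto
  \<comment> \<open>Points of different blocks may carry different signs; absolute values remove
    them, so equal signed indices mean equal indices.\<close>
  have abs: "\<bar>s * int a\<bar> = int a" if "s \<in> {1, -1}" for s a using that by auto
  show "inj_on (\<lambda>p. r (block I (fst p)) * int (fst p)) (supp P)"
  proof (rule inj_onI)
    fix p q assume pq: "p \<in> supp P" "q \<in> supp P"
      and eq: "r (block I (fst p)) * int (fst p) = r (block I (fst q)) * int (fst q)"
    have "int (fst p) = int (fst q)" using arg_cong[OF eq, of abs] unfolding abs[OF r] .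
    then show "p = q" using inj_onD[OF permutation_matrix_rows(1)[OF perm]] pq by simp
  qed
  show "inj_on (\<lambda>p. c (block J (snd p)) * int (snd p)) (supp P)"
  proof (rule inj_onI)
    fix p q assume pq: "p \<in> supp P" "q \<in> supp P"
      and eq: "c (block J (snd p)) * int (snd p) = c (block J (snd q)) * int (snd q)"
    have "int (snd p) = int (snd q)" using arg_cong[OF eq, of abs] unfolding abs[OF c] .
    then show "p = q" using inj_onD[OF permutation_matrix_cols(1)[OF perm]] pq by simp
  qed
  fix p q assume pq: "p \<in> supp P" "q \<in> supp P"
    and eq: "block I (fst p) = block I (fst q)" "block J (snd p) = block J (snd q)"
  let ?k = "block I (fst q)" and ?l = "block J (snd q)"
  have M: "M $$ (?k, ?l) = r ?k * c ?l"
    using M_partition_cell(1)[OF part pq eq] rc eq by simp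
  have neq: "p = q \<or> fst p \<noteq> fst q" "p = q \<or> snd p \<noteq> snd q"
    using pq permutation_matrix_rows(1)[OF perm] permutation_matrix_cols(1)[OF perm]
    by (auto simp: inj_on_def)
  \<comment> \<open>Used for both orders of the two points, so that the one-sided monotonicity on a
    cell becomes an equivalence.\<close>
  note cell_pq = M_partition_cell[OF part pq eq, unfolded eq]
    and cell_qp = M_partition_cell[OF part pq(2,1) eq[symmetric]]
  have inc: "(fst p < fst q \<longleftrightarrow> snd p < snd q) \<and> (fst q < fst p \<longleftrightarrow> snd q < snd p)" if "r ?k * c ?l = 1"
  proof -
    have "M $$ (?k, ?l) = 1" using M that by simp
    from cell_pq(2)[OF this] cell_qp(2)[OF this] show ?thesis
      using neq by (cases "fst p" "fst q" rule: linorder_cases) auto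
  qed
  have dec: "(fst p < fst q \<longleftrightarrow> snd q < snd p) \<and> (fst q < fst p \<longleftrightarrow> snd p < snd q)" if "r ?k * c ?l = -1"
  proof -
    have "M $$ (?k, ?l) = -1" using M that by simp
    from cell_pq(3)[OF this] cell_qp(3)[OF this] show ?thesis
      using neq by (cases "fst p" "fst q" rule: linorder_cases) auto
  qed
  have "r ?k = 1 \<or> r ?k = -1" "c ?l = 1 \<or> c ?l = -1" using r c by auto
  then show "r (block I (fst p)) * int (fst p) < r (block I (fst q)) * int (fst q) \<longleftrightarrow>
    c (block J (snd p)) * int (snd p) < c (block J (snd q)) * int (snd q)"
    unfolding eq by (elim disjE) (use inc dec in simp_all)
qed

lemma sorted_wrt_nths: "sorted_wrt Q xs \<Longrightarrow> sorted_wrt Q (nths xs N)"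
  by (induction xs arbitrary: N) (auto simp: nths_Cons dest: in_set_nthsD)

text \<open>Whether \<open>u a < u b\<close> holds depends only on \<open>K\<close>,
  \<open>s\<close> and the positions: different blocks compare by number, and inside a block the
  sign converts the order of positions into that of values. This is why the word of cells determines
  the matrix.\<close>

lemma blockwise_same_order:
  fixes u v K :: "nat \<Rightarrow> nat" and s :: "nat \<Rightarrow> int"
  assumes "\<And>k. s k \<in> {1, -1}"
    and u: "\<And>a b. a < m \<Longrightarrow> b < m \<Longrightarrow> K a < K b \<Longrightarrow> u a < u b"
      "\<And>a b. a < b \<Longrightarrow> b < m \<Longrightarrow> K a = K b \<Longrightarrow> s (K a) * int (u a) < s (K b) * int (u b)"
    and v: "\<And>a b. a < m \<Longrightarrow> b < m \<Longrightarrow> K a < K b \<Longrightarrow> v a < v b"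
      "\<And>a b. a < b \<Longrightarrow> b < m \<Longrightarrow> K a = K b \<Longrightarrow> s (K a) * int (v a) < s (K b) * int (v b)"
    and "a < m" "b < m"
  shows "u a < u b \<longleftrightarrow> v a < v b"
proof (cases "K a" "K b" rule: linorder_cases)
  case less
  then show ?thesis using u(1)[of a b] v(1)[of a b] assms(6,7) by simp
next
  case greater
  then have "u b < u a" "v b < v a" using u(1)[of b a] v(1)[of b a] assms(6,7) by simp_all
  then show ?thesis by simp
next
  case equal
  have s: "s (K b) = 1 \<or> s (K b) = -1" using assms(1) by auto
  show ?thesis
  proof (cases a b rule: linorder_cases)
    case less
    have "s (K b) * int (u a) < s (K b) * int (u b)" "s (K b) * int (v a) < s (K b) * int (v b)"
      using u(2)[OF less assms(7) equal] v(2)[OF less assms(7) equal] equal by simp_all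
    then show ?thesis using s by (elim disjE) simp_all
  next
    case greater
    have "s (K b) * int (u b) < s (K b) * int (u a)" "s (K b) * int (v b) < s (K b) * int (v a)"
      using u(2)[OF greater assms(6) equal[symmetric]] v(2)[OF greater assms(6) equal[symmetric]]
        equal by simp_all
    then show ?thesis using s by (elim disjE) simp_all
  qed simp
qed

definition cell :: "nat list \<Rightarrow> nat list \<Rightarrow> nat \<times> nat \<Rightarrow> nat \<times> nat" where
  "cell I J p = (block I (fst p), block J (snd p))"

lemma cell_eq_iff:
  assumes "M_partition M P I J" "p \<in> supp P" "k < dim_row M" "l < dim_col M"
  shows "cell I J p = (k, l) \<longleftrightarrow> p \<in> part_interval I k \<times> part_interval J l"
proof -
  have div: "division (dim_row M) (dim_row P) I" "division (dim_col M) (dim_col P) J"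
    using assms(1) by (auto simp: M_partition_def)
  have dims: "fst p < dim_row P" "snd p < dim_col P" using assms(2) by (auto simp: supp_def)
  show ?thesis
    using block_in_interval(2)[OF div(1) dims(1)] block_in_interval(2)[OF div(2) dims(2)]
      block_eq[OF div(1) assms(3), of "fst p"] block_eq[OF div(2) assms(4), of "snd p"]
    unfolding cell_def mem_Times_iff by auto
qed

lemma image_Int_eqI: "(\<And>x. x \<in> S \<Longrightarrow> h x \<in> A \<longleftrightarrow> x \<in> B) \<Longrightarrow> h ` S \<inter> A = h ` (S \<inter> B)"
  by auto

text \<open>The embedding of words selects points of \<open>P\<close> that lie, one by one, in the
  same cells as the points of \<open>P'\<close>. Both lists are adapted, so corresponding points
  have the same relative order in rows and columns, and the selected points form the required set
  \<open>X\<close>.\<close>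

lemma part_le_if_subseq:
  assumes part: "M_partition M P I J"
    and perm': "permutation_matrix P'" and part': "M_partition M P' I' J'"
    and xs: "set xs = supp P" "adapted r c I J xs"
    and xs': "distinct xs'" "set xs' = supp P'" "adapted r c I' J' xs'"
    and r: "\<And>k. r k \<in> {1, -1}" and c: "\<And>l. c l \<in> {1, -1}"
    and sub: "subseq (map (cell I' J') xs') (map (cell I J) xs)"
  shows "part_le M (P', I', J') (P, I, J)"
proof -
  obtain N where N: "map (cell I' J') xs' = nths (map (cell I J) xs) N"
    using sub by (auto simp: subseq_conv_nths)
  define ys where "ys = nths xs N"
  have cells: "map (cell I J) ys = map (cell I' J') xs'" using N by (simp add: ys_def nths_map)
  define m where "m = length xs'"
  have len: "length ys = m" using arg_cong[OF cells, of length] by (simp add: m_def)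
  have cell_nth: "cell I J (ys ! a) = cell I' J' (xs' ! a)" if "a < m" for a
    using arg_cong[OF cells, of "\<lambda>zs. zs ! a"] that len by (simp add: m_def)
  have ys_supp: "set ys \<subseteq> supp P" using xs(1) set_nths_subset[of xs N] by (simp add: ys_def)
  have ys_adapted: "adapted r c I J ys"
    using xs(2) unfolding adapted_def ys_def by (rule sorted_wrt_nths)
  have in_supp: "xs' ! a \<in> supp P'" "ys ! a \<in> supp P" if "a < m" for a
    using that xs'(2) ys_supp len by (auto simp: m_def)
  have div: "division (dim_row M) (dim_row P) I" "division (dim_col M) (dim_col P) J"
    "division (dim_row M) (dim_row P') I'" "division (dim_col M) (dim_col P') J'"
    using part part' by (auto simp: M_partition_def)
  have dims: "fst (xs' ! a) < dim_row P'" "snd (xs' ! a) < dim_col P'"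
    "fst (ys ! a) < dim_row P" "snd (ys ! a) < dim_col P" if "a < m" for a
    using in_supp[OF that] by (auto simp: supp_def)
  have blocks: "block I (fst (ys ! a)) = block I' (fst (xs' ! a))"
    "block J (snd (ys ! a)) = block J' (snd (xs' ! a))" if "a < m" for a
    using cell_nth[OF that] by (simp_all add: cell_def)
  \<comment> \<open>Corresponding points of \<open>xs'\<close> and \<open>ys\<close> share their
    block number, which serves as the common \<open>K\<close>.\<close>
  have row_order: "fst (xs' ! a) < fst (xs' ! b) \<longleftrightarrow> fst (ys ! a) < fst (ys ! b)" if "a < m" "b < m" for a b
  proof (rule blockwise_same_order[of r m "\<lambda>a. block I' (fst (xs' ! a))", OF r _ _ _ _ that])
    show "fst (xs' ! a) < fst (xs' ! b)"
      if "a < m" "b < m" "block I' (fst (xs' ! a)) < block I' (fst (xs' ! b))" for a b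
      using that dims block_less[OF div(3)] by blast
    show "fst (ys ! a) < fst (ys ! b)"
      if "a < m" "b < m" "block I' (fst (xs' ! a)) < block I' (fst (xs' ! b))" for a b
      using that dims block_less[OF div(1)] blocks by metis
    show "r (block I' (fst (xs' ! a))) * int (fst (xs' ! a)) < r (block I' (fst (xs' ! b))) * int (fst (xs' ! b))"
      if "a < b" "b < m" "block I' (fst (xs' ! a)) = block I' (fst (xs' ! b))" for a b
      using sorted_wrt_nth_less[OF xs'(3)[unfolded adapted_def]] that by (simp add: m_def)
    show "r (block I' (fst (xs' ! a))) * int (fst (ys ! a)) < r (block I' (fst (xs' ! b))) * int (fst (ys ! b))"
      if "a < b" "b < m" "block I' (fst (xs' ! a)) = block I' (fst (xs' ! b))" for a b
      using sorted_wrt_nth_less[OF ys_adapted[unfolded adapted_def], of a b] that blocks len by simp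
  qed
  have col_order: "snd (xs' ! a) < snd (xs' ! b) \<longleftrightarrow> snd (ys ! a) < snd (ys ! b)" if "a < m" "b < m" for a b
  proof (rule blockwise_same_order[of c m "\<lambda>a. block J' (snd (xs' ! a))", OF c _ _ _ _ that])
    show "snd (xs' ! a) < snd (xs' ! b)"
      if "a < m" "b < m" "block J' (snd (xs' ! a)) < block J' (snd (xs' ! b))" for a b
      using that dims block_less[OF div(4)] by blast
    show "snd (ys ! a) < snd (ys ! b)"
      if "a < m" "b < m" "block J' (snd (xs' ! a)) < block J' (snd (xs' ! b))" for a b
      using that dims block_less[OF div(2)] blocks by metis
    show "c (block J' (snd (xs' ! a))) * int (snd (xs' ! a)) < c (block J' (snd (xs' ! b))) * int (snd (xs' ! b))"
      if "a < b" "b < m" "block J' (snd (xs' ! a)) = block J' (snd (xs' ! b))" for a b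
      using sorted_wrt_nth_less[OF xs'(3)[unfolded adapted_def]] that by (simp add: m_def)
    show "c (block J' (snd (xs' ! a))) * int (snd (ys ! a)) < c (block J' (snd (xs' ! b))) * int (snd (ys ! b))"
      if "a < b" "b < m" "block J' (snd (xs' ! a)) = block J' (snd (xs' ! b))" for a b
      using sorted_wrt_nth_less[OF ys_adapted[unfolded adapted_def], of a b] that blocks len by simp
  qed
  \<comment> \<open>Sends the point at position \<open>a\<close> of \<open>xs'\<close> to the one at
    position \<open>a\<close> of \<open>ys\<close>; this is well defined because \<open>xs'\<close>
    is distinct.\<close>
  define h where "h p = the (map_of (zip xs' ys) p)" for p
  have h: "h (xs' ! a) = ys ! a" if "a < m" for a
    using that map_of_zip_nth[of xs' ys a] xs'(1) len by (simp add: h_def m_def)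
  have ex_nth: "\<exists>a<m. p = xs' ! a" if "p \<in> supp P'" for p
    using that by (metis in_set_conv_nth m_def xs'(2))
  have rows: "fst p < fst q \<longleftrightarrow> fst (h p) < fst (h q)" if "p \<in> supp P'" "q \<in> supp P'" for p q
    using ex_nth[OF that(1)] ex_nth[OF that(2)] row_order h by auto
  have cols: "snd p < snd q \<longleftrightarrow> snd (h p) < snd (h q)" if "p \<in> supp P'" "q \<in> supp P'" for p q
    using ex_nth[OF that(1)] ex_nth[OF that(2)] col_order h by auto
  have h_supp: "h p \<in> supp P" "cell I J (h p) = cell I' J' p" if "p \<in> supp P'" for p
    using ex_nth[OF that] h in_supp(2) cell_nth by auto
  have inj: "inj_on h (supp P')"
    using inj_onD[OF pick_image(1)[OF permutation_matrix_rows[OF perm'] rows]] by (intro inj_onI) metis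
  have card: "card (h ` supp P' \<inter> part_interval I k \<times> part_interval J l) =
      card (supp P' \<inter> part_interval I' k \<times> part_interval J' l)"
    if "k < dim_row M" "l < dim_col M" for k l
  proof -
    have "h p \<in> part_interval I k \<times> part_interval J l \<longleftrightarrow>
        p \<in> part_interval I' k \<times> part_interval J' l" if p: "p \<in> supp P'" for p
      using cell_eq_iff[OF part h_supp(1)[OF p] \<open>k < _\<close> \<open>l < _\<close>]
        cell_eq_iff[OF part' p \<open>k < _\<close> \<open>l < _\<close>] h_supp(2)[OF p] by metis
    then have "h ` supp P' \<inter> part_interval I k \<times> part_interval J l =
        h ` (supp P' \<inter> part_interval I' k \<times> part_interval J' l)"
      by (rule image_Int_eqI)
    then show ?thesis
      using card_image[OF inj_on_subset[OF inj Int_lower1]] by metis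
  qed
  show ?thesis
    unfolding part_le.simps
  proof (intro exI conjI allI impI)
    show "h ` supp P' \<subseteq> supp P" using h_supp(1) by blast
    show "red (delta_mat (h ` supp P')) = P'" by (rule red_delta_mat_image[OF perm' rows cols])
  qed (rule card)
qed

section \<open>Descending sequences\<close>

lemma card_by_blocks:
  assumes "division m n I" "finite S" "f ` S \<subseteq> {..<n}"
  shows "card S = (\<Sum>l<m. card {p \<in> S. f p \<in> part_interval I l})"
proof -
  have less: "f p < n" if "p \<in> S" for p using that assms(3) by auto
  have "f p \<in> part_interval I l \<longleftrightarrow> block I (f p) = l" if "l < m" "p \<in> S" for l p
    using block_eq[OF assms(1) that(1)] block_in_interval(2)[OF assms(1) less[OF that(2)]] by metis
  then have eq: "{p \<in> S. f p \<in> part_interval I l} = {p \<in> S. block I (f p) = l}" if "l < m" for l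
    using that by blast
  have "(\<lambda>p. block I (f p)) ` S \<subseteq> {..<m}"
    using block_in_interval(1)[OF assms(1) less] by auto
  from sum.group[OF assms(2) finite_lessThan this, of "\<lambda>_. 1::nat"]
  have "card S = (\<Sum>l<m. card {p \<in> S. block I (f p) = l})" by simp
  also have "\<dots> = (\<Sum>l<m. card {p \<in> S. f p \<in> part_interval I l})"
    by (rule sum.cong) (simp_all only: eq lessThan_iff)
  finally show ?thesis .
qed

lemma division_eqI:
  assumes "division m n I" "division m n I'"
    and "\<And>k. k < m \<Longrightarrow> I ! (k + 1) - I ! k = I' ! (k + 1) - I' ! k"
  shows "I = I'"
proof (rule nth_equalityI)
  show "length I = length I'" using assms by (simp add: division_def)
  have "I ! k = I' ! k" if "k \<le> m" for k
    using that
  proof (induction k)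
    case 0
    then show ?case using assms by (simp add: division_def)
  next
    case (Suc k)
    \<comment> \<open>Subtraction on naturals truncates; monotonicity makes the differences genuine,
      so they determine the next end point.\<close>
    then show ?case
      using assms(3)[of k] division_mono[OF assms(1), of k "k + 1"]
        division_mono[OF assms(2), of k "k + 1"] by simp
  qed
  then show "I ! k = I' ! k" if "k < length I" for k
    using that assms by (simp add: division_def)
qed

text \<open>Each row and each column of \<open>P\<close> contains one point, so the length of an
  interval counts the points of its block, here split into cells. Hence the cell counts compared by
  \<open>part_le\<close> determine both divisions.\<close>

lemma interval_length_eq_sum:
  assumes "permutation_matrix P" "M_partition M P I J"
  shows "k < dim_row M \<Longrightarrow> I ! (k + 1) - I ! k =
      (\<Sum>l<dim_col M. card (supp P \<inter> part_interval I k \<times> part_interval J l))"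
    and "l < dim_col M \<Longrightarrow> J ! (l + 1) - J ! l =
      (\<Sum>k<dim_row M. card (supp P \<inter> part_interval I k \<times> part_interval J l))"
proof -
  have div: "division (dim_row M) (dim_row P) I" "division (dim_col M) (dim_row P) J"
    using assms by (auto simp: M_partition_def dim_col_permutation_matrix)
  note rows = permutation_matrix_rows[OF assms(1)] and cols = permutation_matrix_cols[OF assms(1)]
  {
    assume k: "k < dim_row M"
    let ?S = "{p \<in> supp P. fst p \<in> part_interval I k}"
    have "I ! (k + 1) \<le> dim_row P"
      using division_mono[OF div(1), of "k + 1" "dim_row M"] k div(1) by (simp add: division_def)
    then have "part_interval I k \<subseteq> fst ` supp P" using rows(2) by auto
    then have "fst ` ?S = part_interval I k" by blast
    then have "card ?S = I ! (k + 1) - I ! k"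
      using card_image[OF inj_on_subset[OF rows(1), of ?S]] by auto
    moreover have "card ?S = (\<Sum>l<dim_col M. card {p \<in> ?S. snd p \<in> part_interval J l})"
      using cols(2) by (intro card_by_blocks[OF div(2)]) (auto simp: finite_supp)
    moreover have "{p \<in> ?S. snd p \<in> part_interval J l} = supp P \<inter> part_interval I k \<times> part_interval J l" for l
      by (auto simp: mem_Times_iff)
    ultimately show "I ! (k + 1) - I ! k =
      (\<Sum>l<dim_col M. card (supp P \<inter> part_interval I k \<times> part_interval J l))" by simp
  }
  {
    assume l: "l < dim_col M"
    let ?S = "{p \<in> supp P. snd p \<in> part_interval J l}"
    have "J ! (l + 1) \<le> dim_row P"
      using division_mono[OF div(2), of "l + 1" "dim_col M"] l div(2) by (simp add: division_def)
    then have "part_interval J l \<subseteq> snd ` supp P" using cols(2) by auto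
    then have "snd ` ?S = part_interval J l" by blast
    then have "card ?S = J ! (l + 1) - J ! l"
      using card_image[OF inj_on_subset[OF cols(1), of ?S]] by auto
    moreover have "card ?S = (\<Sum>k<dim_row M. card {p \<in> ?S. fst p \<in> part_interval I k})"
      using rows(2) by (intro card_by_blocks[OF div(1)]) (auto simp: finite_supp)
    moreover have "{p \<in> ?S. fst p \<in> part_interval I k} = supp P \<inter> part_interval I k \<times> part_interval J l" for k
      by (auto simp: mem_Times_iff)
    ultimately show "J ! (l + 1) - J ! l =
      (\<Sum>k<dim_row M. card (supp P \<inter> part_interval I k \<times> part_interval J l))" by simp
  }
qed

text \<open>If no point is lost, then \<open>X\<close> is the whole support and
  \<open>P' = P\<close>. Equal cell counts then force equal divisions, so the two triples
  coincide.\<close>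

lemma part_le_dim_less:
  assumes perm: "permutation_matrix P" and part: "M_partition M P I J"
    and part': "M_partition M P' I' J'"
    and le: "part_le M (P', I', J') (P, I, J)" and neq: "(P', I', J') \<noteq> (P, I, J)"
  shows "dim_row P' < dim_row P"
proof (rule ccontr)
  assume not_less: "\<not> dim_row P' < dim_row P"
  obtain X where X: "X \<subseteq> supp P" "red (delta_mat X) = P'"
    and card: "\<And>k l. k < dim_row M \<Longrightarrow> l < dim_col M \<Longrightarrow>
      card (X \<inter> part_interval I k \<times> part_interval J l) =
      card (supp P' \<inter> part_interval I' k \<times> part_interval J' l)"
    using le unfolding part_le.simps by blast
  note rows = permutation_matrix_rows[OF perm]
  \<comment> \<open>The reduced matrix has one row for each row met by \<open>X\<close>. If there
    are at least as many as in \<open>P\<close>, every row is met, and as a row of \<open>P\<close>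
    holds only one point, \<open>X\<close> contains all points.\<close>
  have "dim_row P' = card (fst ` X)"
    using red_delta_mat(1)[OF finite_subset[OF X(1) finite_supp]] X(2) by simp
  then have "card (fst ` supp P) \<le> card (fst ` X)" using not_less rows(2) by simp
  then have "fst ` X = fst ` supp P"
    using X(1) by (intro card_seteq) (auto simp: finite_supp)
  then have "X = supp P" using inj_on_image_eq_iff[OF rows(1) X(1)] by simp
  moreover have "red (delta_mat (id ` supp P)) = P" by (rule red_delta_mat_image[OF perm]) simp_all
  ultimately have P': "P' = P" using X(2) by simp
  have div: "division (dim_row M) (dim_row P) I" "division (dim_col M) (dim_col P) J"
    "division (dim_row M) (dim_row P) I'" "division (dim_col M) (dim_col P) J'"
    using part part' by (auto simp: M_partition_def P')
  have "I = I'"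
    using interval_length_eq_sum(1)[OF perm part] interval_length_eq_sum(1)[OF perm part'[unfolded P']]
      card \<open>X = supp P\<close> P' by (intro division_eqI[OF div(1,3)]) simp
  moreover have "J = J'"
    using interval_length_eq_sum(2)[OF perm part] interval_length_eq_sum(2)[OF perm part'[unfolded P']]
      card \<open>X = supp P\<close> P' by (intro division_eqI[OF div(2,4)]) simp
  ultimately show False using neq P' by simp
qed

section \<open>Partial well-ordering of \<open>Part M\<close>\<close>

theorem theorem3p3:
  fixes M :: "int mat"
  assumes "elements_mat M \<subseteq> {0, 1, -1}"
    and "undirected_forest (bip_graph M)"
  shows "partially_well_ordered_on (Part M) (part_le M)"
proof -
  have leafy: "leafy (supp M)" using assms(2) by (rule leafy_if_undirected_forest)
  have "M $$ e \<in> {1, -1}" if e: "e \<in> supp M" for e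
  proof -
    obtain k l where e: "e = (k, l)" "k < dim_row M" "l < dim_col M" "M $$ e \<noteq> 0"
      using e by (auto simp: supp_def)
    then have "M $$ e \<in> elements_mat M" by blast
    then show ?thesis using assms(1) e(4) by blast
  qed
  then obtain r c where r: "\<And>k. r k \<in> {1, -1}" and c: "\<And>l. c l \<in> {1, -1}"
    and rc: "\<And>k l. (k, l) \<in> supp M \<Longrightarrow> M $$ (k, l) = r k * c l"
    using leafy_sign_assignment[OF finite_supp leafy, of "($$) M"] by blast
  \<comment> \<open>Each triple is encoded by the word of cells of an adapted list; the finite
    alphabet for Higman's lemma is \<open>supp M\<close>.\<close>
  have good: "\<exists>i j. i < j \<and> part_le M (f i) (f j)" if f: "\<And>n. f n \<in> Part M" for f :: "nat \<Rightarrow> _"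
  proof -
    define P I J where "P n = fst (f n)" and "I n = fst (snd (f n))" and "J n = snd (snd (f n))" for n
    have f_eq: "f n = (P n, I n, J n)" for n by (simp add: P_def I_def J_def)
    have perm: "permutation_matrix (P n)" and part: "M_partition M (P n) (I n) (J n)" for n
      using f[of n] by (auto simp: Part_def f_eq)
    have "\<forall>n. \<exists>xs. distinct xs \<and> set xs = supp (P n) \<and> adapted r c (I n) (J n) xs"
      using ex_adapted[OF leafy perm part r c rc] by blast
    then obtain xs where xs: "\<And>n. distinct (xs n)" "\<And>n. set (xs n) = supp (P n)"
      "\<And>n. adapted r c (I n) (J n) (xs n)" by metis
    have "set (map (cell (I n) (J n)) (xs n)) \<subseteq> supp M" for n
      using M_partition_cell(1)[OF part _ _ refl refl] xs(2) by (auto simp: cell_def)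
    then obtain i j where "i < j" and
      sub: "subseq (map (cell (I i) (J i)) (xs i)) (map (cell (I j) (J j)) (xs j))"
      using higman_finite_alphabet[OF finite_supp, of "\<lambda>n. map (cell (I n) (J n)) (xs n)"] by blast
    have "part_le M (f i) (f j)"
      unfolding f_eq
      by (rule part_le_if_subseq[OF part perm part xs(2)[of j] xs(3) xs(1)[of i] xs(2,3) r c sub])
    with \<open>i < j\<close> show ?thesis by blast
  qed
  show ?thesis
    unfolding partially_well_ordered_on_def
  proof (intro conjI notI)
    assume "\<exists>B\<subseteq>Part M. infinite B \<and> (\<forall>x\<in>B. \<forall>y\<in>B. x \<noteq> y \<longrightarrow> \<not> part_le M x y)"
    then obtain B where B: "B \<subseteq> Part M" "infinite B"
      "\<And>x y. x \<in> B \<Longrightarrow> y \<in> B \<Longrightarrow> x \<noteq> y \<Longrightarrow> \<not> part_le M x y" by blast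
    \<comment> \<open>An injective sequence in the antichain: the comparable pair found in it then
      consists of two different elements.\<close>
    obtain f :: "nat \<Rightarrow> _" where f: "inj f" "range f \<subseteq> B"
      using infinite_countable_subset[OF B(2)] by blast
    obtain i j where ij: "i < j" "part_le M (f i) (f j)" using good[of f] f(2) B(1) by blast
    then have "f i \<noteq> f j" using f(1) by (auto simp: inj_def)
    then show False using B(3)[of "f i" "f j"] f(2) ij(2) by blast
  next
    assume "\<exists>f :: nat \<Rightarrow> _. \<forall>n. f n \<in> Part M \<and> part_le M (f (Suc n)) (f n) \<and> f (Suc n) \<noteq> f n"
    then obtain f :: "nat \<Rightarrow> int mat \<times> nat list \<times> nat list" where f: "\<And>n. f n \<in> Part M"
      "\<And>n. part_le M (f (Suc n)) (f n)" "\<And>n. f (Suc n) \<noteq> f n" by blast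
    have "dim_row (fst (f (Suc n))) < dim_row (fst (f n))" for n
      using f(1)[of n] f(1)[of "Suc n"] f(2)[of n] f(3)[of n] part_le_dim_less
      by (cases "f n"; cases "f (Suc n)") (auto simp: Part_def simp del: part_le.simps)
    then show False using wf_no_infinite_down_chainE[OF wf_less, of "\<lambda>n. dim_row (fst (f n))"] by blast
  qed
qed

end
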